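(* Let $X=Y^\star$ and $j$ be as in the context. Let $x\in\operatorname{dom}(j)$ and $g\in\partial j(x)$ be given. Suppose that there exist a set $Z\subset\mathcal K_j^{x,g}$ and a functional $Q:\mathcal K_j^{x,g}\to[0,\infty)$ such that (i) for all $z\in\mathcal K_j^{x,g}$ it holds $Q_j^{x,g}(z)\ge Q(z)$, (ii) for all $z\in Z$ and all $\{t_n\}\subset(0,\infty)$ with $t_n\searrow0$ there exists a sequence $\{z_n\}\subset X$ satisfying $z_n\stackrel{\star}{\rightharpoonup}z$, $\|z_n\|_X\to\|z\|_X$, and $$Q(z)=\lim_{n\to\infty}\frac{j(x+t_nz_n)-j(x)-t_n\langle g,z_n\rangle}{t_n^2/2},$$ (iii) for all $z\in\mathcal K_j^{x,g}$ there exists a sequence $\{z_k\}\subset Z$ with $z_k\stackrel{\star}{\rightharpoonup}z$, $\|z_k\|_X\to\|z\|_X$ and $Q(z)\ge\liminf_{k\to\infty}Q(z_k)$. Then $Q=Q_j^{x,g}$ (on $\mathcal K_j^{x,g}$) and $j$ is strictly twice epi-differentiable in $x$ for $g$. If, moreover, the sequences in (ii) and (iii) can be chosen to be strongly convergent, then $j$ is even strongly twice epi-differentiable in $x$ for $g$.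
   Context: Setting: $Y$ is a (real) Banach space that is reflexive or separable, $X=Y^\star$ is its topological dual, $\langle\cdot,\cdot\rangle$ is the dual pairing between $Y$ and $X$, $j:X\to(-\infty,\infty]$ is proper (not necessarily convex), $\operatorname{dom}(j)=\{x\in X: j(x)\in\mathbb R\}$, and $\partial j(x):=\{g\in Y: j(z)\ge j(x)+\langle g,z-x\rangle\ \forall z\in X\}$. Weak-$\star$ second subderivative: for $x\in\operatorname{dom}(j)$, $g\in Y$, $$Q_j^{x,g}(z):=\inf\Big\{\liminf_{n\to\infty}\frac{j(x+t_nz_n)-j(x)-t_n\langle g,z_n\rangle}{t_n^2/2}\ \Big|\ t_n\searrow0,\ z_n\stackrel{\star}{\rightharpoonup}z\Big\},\quad z\in X,$$ and $\mathcal K_j^{x,g}:=\{z\in X: Q_j^{x,g}(z)<+\infty\}$. $j$ is strictly (respectively strongly) twice epi-differentiable in $x$ for $g$ if for every $z\in X$ and every $\{t_n\}\subset(0,\infty)$ with $t_n\searrow0$ there is a sequence $\{z_n\}\subset X$ with $z_n\stackrel{\star}{\rightharpoonup}z$ and $\|z_n\|_X\to\|z\|_X$ (respectively $z_n\to z$ in norm) and $Q_j^{x,g}(z)=\lim_{n\to\infty}\frac{j(x+t_nz_n)-j(x)-t_n\langle g,z_n\rangle}{t_n^2/2}$. *)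

theory Defs
  imports "HOL-Analysis.Analysis"
begin

text \<open>
  Throughout, \<open>Y\<close> is the Banach space given by a type \<open>'a::banach\<close>, its topological dual \<open>X\<close> is the
  type \<open>'a \<Rightarrow>\<^sub>L real\<close> with the operator norm, and the pairing of \<open>g\<close> in \<open>Y\<close> with \<open>z\<close> in \<open>X\<close> is
  \<open>blinfun_apply z g\<close>.
\<close>

definition reflexive_space :: "'a::real_normed_vector itself \<Rightarrow> bool" where
  "reflexive_space _ \<longleftrightarrow>
     (\<forall>\<phi> :: ('a \<Rightarrow>\<^sub>L real) \<Rightarrow>\<^sub>L real. \<exists>y :: 'a. \<forall>f. blinfun_apply \<phi> f = blinfun_apply f y)"

definition weak_star_lim ::
    "(nat \<Rightarrow> ('a::real_normed_vector \<Rightarrow>\<^sub>L real)) \<Rightarrow> ('a \<Rightarrow>\<^sub>L real) \<Rightarrow> bool" where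
  "weak_star_lim zs z \<longleftrightarrow> (\<forall>y. (\<lambda>n. blinfun_apply (zs n) y) \<longlonglongrightarrow> blinfun_apply z y)"

text \<open>
  The arrow in \<open>t\<^sub>n \<searrow> 0\<close> is read as (weakly) decreasing convergence. Every positive null sequence
  can be rearranged into a decreasing one, so dropping monotonicity would not change any notion below.
\<close>

definition pos_decreasing_null :: "(nat \<Rightarrow> real) \<Rightarrow> bool" where
  "pos_decreasing_null t \<longleftrightarrow> (\<forall>n. t n > 0) \<and> decseq t \<and> t \<longlonglongrightarrow> 0"

definition proper_fun :: "('b \<Rightarrow> ereal) \<Rightarrow> bool" where
  "proper_fun j \<longleftrightarrow> (\<forall>x. j x \<noteq> -\<infinity>) \<and> (\<exists>x. j x \<noteq> \<infinity>)"

definition effective_dom :: "('b \<Rightarrow> ereal) \<Rightarrow> 'b set" where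
  "effective_dom j = {x. j x \<in> range ereal}"

definition subdifferential ::
    "(('a::real_normed_vector \<Rightarrow>\<^sub>L real) \<Rightarrow> ereal) \<Rightarrow> ('a \<Rightarrow>\<^sub>L real) \<Rightarrow> 'a set" where
  "subdifferential j x = {g. \<forall>z. j z \<ge> j x + ereal (blinfun_apply (z - x) g)}"

definition second_quot ::
    "(('a::real_normed_vector \<Rightarrow>\<^sub>L real) \<Rightarrow> ereal) \<Rightarrow> ('a \<Rightarrow>\<^sub>L real) \<Rightarrow> 'a \<Rightarrow>
     real \<Rightarrow> ('a \<Rightarrow>\<^sub>L real) \<Rightarrow> ereal" where
  "second_quot j x g t z =
     (j (x + t *\<^sub>R z) - j x - ereal (t * blinfun_apply z g)) / ereal (t\<^sup>2 / 2)"

definition second_subderiv ::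
    "(('a::real_normed_vector \<Rightarrow>\<^sub>L real) \<Rightarrow> ereal) \<Rightarrow> ('a \<Rightarrow>\<^sub>L real) \<Rightarrow> 'a \<Rightarrow>
     ('a \<Rightarrow>\<^sub>L real) \<Rightarrow> ereal" where
  "second_subderiv j x g z =
     Inf {liminf (\<lambda>n. second_quot j x g (t n) (zs n)) | t zs.
            pos_decreasing_null t \<and> weak_star_lim zs z}"

definition critical_set ::
    "(('a::real_normed_vector \<Rightarrow>\<^sub>L real) \<Rightarrow> ereal) \<Rightarrow> ('a \<Rightarrow>\<^sub>L real) \<Rightarrow> 'a \<Rightarrow>
     ('a \<Rightarrow>\<^sub>L real) set" where
  "critical_set j x g = {z. second_subderiv j x g z < \<infinity>}"

definition strictly_twice_epi_diff ::
    "(('a::real_normed_vector \<Rightarrow>\<^sub>L real) \<Rightarrow> ereal) \<Rightarrow> ('a \<Rightarrow>\<^sub>L real) \<Rightarrow> 'a \<Rightarrow> bool" where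
  "strictly_twice_epi_diff j x g \<longleftrightarrow>
     (\<forall>z t. pos_decreasing_null t \<longrightarrow>
        (\<exists>zs. weak_star_lim zs z \<and> (\<lambda>n. norm (zs n)) \<longlonglongrightarrow> norm z \<and>
              (\<lambda>n. second_quot j x g (t n) (zs n)) \<longlonglongrightarrow> second_subderiv j x g z))"

definition strongly_twice_epi_diff ::
    "(('a::real_normed_vector \<Rightarrow>\<^sub>L real) \<Rightarrow> ereal) \<Rightarrow> ('a \<Rightarrow>\<^sub>L real) \<Rightarrow> 'a \<Rightarrow> bool" where
  "strongly_twice_epi_diff j x g \<longleftrightarrow>
     (\<forall>z t. pos_decreasing_null t \<longrightarrow>
        (\<exists>zs. zs \<longlonglongrightarrow> z \<and>
              (\<lambda>n. second_quot j x g (t n) (zs n)) \<longlonglongrightarrow> second_subderiv j x g z))"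

end

theory Submission
  imports Defs
begin

text \<open>
  Sequences approximating a direction of the critical set by elements of \<open>Z\<close>, combined with the
  recovery sequences of these elements, give a recovery sequence by diagonalisation. Its difference
  quotients have limit superior at most \<open>Q z\<close>, while their limit inferior is at least the second
  subderivative, hence at least \<open>Q z\<close>.

  The diagonal argument needs weak-star convergence of bounded sequences to be testable on
  countably many vectors. For separable \<open>Y\<close> a dense sequence will do. For reflexive \<open>Y\<close> only the
  countable set of all members of the sequences involved matters; a countable set \<open>D\<close> separating
  the points of its closed span \<open>V\<close> suffices: by Hahn-Banach, applied to the limit superior
  \<open>\<lambda>y. limsup (w n y)\<close>, its value at any given \<open>y\<close> is attained by a linear functional dominated
  by this limit superior; reflexivity forces that functional into \<open>V\<close>, and there it is determined
  by its values on \<open>D\<close>.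
\<close>

subsection \<open>Sublinear functionals and the Hahn-Banach theorem\<close>

text \<open>Homogeneity is only an inequality for positive factors, which infima satisfy directly;
  the inverse factor supplies the reverse inequality, and \<open>p 0 = 0\<close> follows.\<close>

definition sublinear :: "('v::real_vector \<Rightarrow> real) \<Rightarrow> bool" where
  "sublinear p \<longleftrightarrow>
     (\<forall>u v. p (u + v) \<le> p u + p v) \<and> (\<forall>t u. t > 0 \<longrightarrow> p (t *\<^sub>R u) \<le> t * p u)"

lemma sublinearI:
  assumes "\<And>u v. p (u + v) \<le> p u + p v" "\<And>t u. t > 0 \<Longrightarrow> p (t *\<^sub>R u) \<le> t * p u"
  shows "sublinear p"
  using assms by (simp add: sublinear_def)

lemma sublinear_add: "sublinear p \<Longrightarrow> p (u + v) \<le> p u + p v"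
  by (simp add: sublinear_def)

lemma sublinear_scale:
  assumes "sublinear p" "t > 0"
  shows "p (t *\<^sub>R u) = t * p u"
proof (rule antisym)
  show "p (t *\<^sub>R u) \<le> t * p u"
    using assms by (simp add: sublinear_def)
  have "p (inverse t *\<^sub>R (t *\<^sub>R u)) \<le> inverse t * p (t *\<^sub>R u)"
    using assms unfolding sublinear_def by (meson inverse_positive_iff_positive)
  then show "t * p u \<le> p (t *\<^sub>R u)"
    using assms by (simp add: field_simps)
qed

lemma sublinear_zero: "sublinear p \<Longrightarrow> p 0 = 0"
  using sublinear_scale[of p 2 0] by simp

lemma sublinear_lower: "sublinear p \<Longrightarrow> - p (- u) \<le> p u"
  using sublinear_add[of p u "- u"] sublinear_zero[of p] by simp

text \<open>Once \<open>p (- v) = - p v\<close>, subadditivity applied to \<open>u + v\<close> and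
  \<open>- v\<close> yields superadditivity; negative scalars reduce to positive ones by
  oddness.\<close>

lemma sublinear_odd_linear:
  assumes p: "sublinear p" and odd: "\<And>u. p (- u) \<le> - p u"
  shows "linear p"
proof (rule linearI)
  have neg: "p (- u) = - p u" for u
    using odd[of u] sublinear_lower[OF p, of "- u"] by simp
  show "p (u + v) = p u + p v" for u v
    using sublinear_add[OF p, of u v] sublinear_add[OF p, of "u + v" "- v"] neg[of v] by simp
  show "p (r *\<^sub>R u) = r *\<^sub>R p u" for r u
  proof (cases r "0 :: real" rule: linorder_cases)
    case less
    then show ?thesis
      using sublinear_scale[OF p, of "- r" u] neg[of "r *\<^sub>R u"] by simp
  qed (auto simp: sublinear_zero[OF p] sublinear_scale[OF p])
qed

text \<open>The infimum of \<open>p (u + t *\<^sub>R w) - t * p w\<close> over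
  \<open>t \<ge> 0\<close> is the classical lowering of \<open>p\<close> along the ray of
  \<open>w\<close>: \<open>t = 0\<close> gives \<open>q u \<le> p u\<close>, and
  \<open>t = 1\<close> gives the bound at \<open>- w\<close>. It serves twice: to fix the value at a
  chosen vector, and to show that minimal sublinear functionals are odd.\<close>

lemma sublinear_decrease:
  assumes p: "sublinear p"
  obtains q where "sublinear q" "\<And>u. q u \<le> p u" "q (- w) \<le> - p w"
proof
  define A where "A u = (\<lambda>t. p (u + t *\<^sub>R w) - t * p w) ` {0..}" for u
  define q where "q u = Inf (A u)" for u
  \<comment> \<open>This keeps the infima finite: \<open>t * p w = p (t *\<^sub>R w)\<close>, and
    \<open>t *\<^sub>R w\<close> is the sum of \<open>u + t *\<^sub>R w\<close> and
    \<open>- u\<close>.\<close>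
  have lb: "- p (- u) \<le> p (u + t *\<^sub>R w) - t * p w" if "t \<ge> 0" for u t
  proof (cases "t = 0")
    case True
    then show ?thesis
      using sublinear_lower[OF p] by simp
  next
    case False
    then show ?thesis
      using that sublinear_add[OF p, of "u + t *\<^sub>R w" "- u"] sublinear_scale[OF p, of t w] by simp
  qed
  have bdd: "bdd_below (A u)" for u
    unfolding A_def by (rule bdd_belowI2[of _ "- p (- u)"]) (use lb in auto)
  have ne: "A u \<noteq> {}" for u
    by (auto simp: A_def)
  have le: "q u \<le> p (u + t *\<^sub>R w) - t * p w" if "t \<ge> 0" for u t
    unfolding q_def by (rule cInf_lower[OF _ bdd]) (use that in \<open>auto simp: A_def\<close>)
  show "sublinear q"
  proof (rule sublinearI)
    fix u v
    \<comment> \<open>Candidates with parameters \<open>t\<close> and \<open>s\<close> combine to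
      one with parameter \<open>s + t\<close>; the two infima are then taken one at a time.\<close>
    have "q (u + v) - (p (v + s *\<^sub>R w) - s * p w) \<le> p (u + t *\<^sub>R w) - t * p w"
      if "s \<ge> 0" "t \<ge> 0" for s t
      using le[of "s + t" "u + v"] that sublinear_add[OF p, of "u + t *\<^sub>R w" "v + s *\<^sub>R w"]
      by (simp add: algebra_simps)
    then have "q (u + v) - (p (v + s *\<^sub>R w) - s * p w) \<le> q u" if "s \<ge> 0" for s
      unfolding q_def[of u] by (intro cInf_greatest[OF ne]) (use that in \<open>auto simp: A_def\<close>)
    then have "q (u + v) - q u \<le> p (v + s *\<^sub>R w) - s * p w" if "s \<ge> 0" for s
      using that by (simp add: algebra_simps)
    then have "q (u + v) - q u \<le> q v"
      unfolding q_def[of v] by (intro cInf_greatest[OF ne]) (auto simp: A_def)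
    then show "q (u + v) \<le> q u + q v"
      by simp
  next
    fix r :: real and u
    assume r: "r > 0"
    have "q (r *\<^sub>R u) / r \<le> p (u + t *\<^sub>R w) - t * p w" if "t \<ge> 0" for t
      using le[of "r * t" "r *\<^sub>R u"] that r sublinear_scale[OF p, of r "u + t *\<^sub>R w"]
      by (simp add: field_simps scaleR_add_right)
    then have "q (r *\<^sub>R u) / r \<le> q u"
      unfolding q_def[of u] by (intro cInf_greatest[OF ne]) (auto simp: A_def)
    then show "q (r *\<^sub>R u) \<le> r * q u"
      using r by (simp add: field_simps)
  qed
  show "q u \<le> p u" for u
    using le[of 0 u] by simp
  show "q (- w) \<le> - p w"
    using le[of 1 "- w"] sublinear_zero[OF p] by simp
qed

text \<open>Zorn's lemma for the reversed pointwise order. A nonempty chain is bounded by its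
  pointwise infimum, which is finite because each member satisfies
  \<open>- p (- u) \<le> - f (- u) \<le> f u\<close>.\<close>

lemma ex_minimal_sublinear:
  assumes p: "sublinear p"
  obtains q where "sublinear q" "q \<le> p" "\<And>r. sublinear r \<Longrightarrow> r \<le> q \<Longrightarrow> r = q"
proof -
  define S where "S = {q. sublinear q \<and> q \<le> p}"
  have po: "partial_order_on S (relation_of (\<lambda>f g. g \<le> f) S)"
    by (rule partial_order_on_relation_ofI) auto
  have ub: "\<exists>u\<in>S. \<forall>a\<in>C. u \<le> a" if C: "C \<in> Chains (relation_of (\<lambda>f g. g \<le> f) S)" for C
  proof (cases "C = {}")
    case True
    then show ?thesis
      using p by (auto simp: S_def)
  next
    case False
    have sub: "sublinear f" "f \<le> p" if "f \<in> C" for f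
      using C that by (auto simp: Chains_def relation_of_def S_def)
    have tot: "f \<le> g \<or> g \<le> f" if "f \<in> C" "g \<in> C" for f g
      using C that by (auto simp: Chains_def relation_of_def)
    define q where "q u = (INF f\<in>C. f u)" for u
    have bdd: "bdd_below ((\<lambda>f. f u) ` C)" for u
    proof (rule bdd_belowI2[of _ "- p (- u)"])
      fix f
      assume "f \<in> C"
      then show "- p (- u) \<le> f u"
        using sublinear_lower[of f u] sub[of f] le_funD[of f p "- u"] by force
    qed
    have le: "q u \<le> f u" if "f \<in> C" for f u
      unfolding q_def by (rule cINF_lower[OF bdd that])
    have "sublinear q"
    proof (rule sublinearI)
      fix u v
      \<comment> \<open>An infimum of sublinear functionals need not be subadditive; in a chain the
        smaller of \<open>f\<close> and \<open>g\<close> serves for both arguments.\<close>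
      have "q (u + v) - g v \<le> f u" if fg: "f \<in> C" "g \<in> C" for f g
        using tot[OF fg]
      proof
        assume "f \<le> g"
        then show ?thesis
          using le[OF fg(1), of "u + v"] sublinear_add[OF sub(1)[OF fg(1)], of u v] le_funD[of f g v]
          by linarith
      next
        assume "g \<le> f"
        then show ?thesis
          using le[OF fg(2), of "u + v"] sublinear_add[OF sub(1)[OF fg(2)], of u v] le_funD[of g f u]
          by linarith
      qed
      then have "q (u + v) - g v \<le> q u" if "g \<in> C" for g
        unfolding q_def[of u] by (intro cINF_greatest[OF False]) (use that in auto)
      then have "q (u + v) - q u \<le> g v" if "g \<in> C" for g
        using that by (simp add: algebra_simps)
      then have "q (u + v) - q u \<le> q v"
        unfolding q_def[of v] by (intro cINF_greatest[OF False]) auto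
      then show "q (u + v) \<le> q u + q v"
        by simp
    next
      fix r :: real and u
      assume r: "r > 0"
      have "q (r *\<^sub>R u) / r \<le> f u" if "f \<in> C" for f
        using le[OF that, of "r *\<^sub>R u"] sublinear_scale[OF sub(1)[OF that] r, of u] r
        by (simp add: field_simps)
      then have "q (r *\<^sub>R u) / r \<le> q u"
        unfolding q_def[of u] by (intro cINF_greatest[OF False]) auto
      then show "q (r *\<^sub>R u) \<le> r * q u"
        using r by (simp add: field_simps)
    qed
    moreover have "q \<le> p"
      using False le sub(2) by (meson ex_in_conv le_funI le_fun_def order_trans)
    ultimately show ?thesis
      using le by (auto simp: S_def le_fun_def)
  qed
  obtain m where m: "m \<in> S" "\<And>a. a \<in> S \<Longrightarrow> a \<le> m \<Longrightarrow> a = m"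
    using predicate_Zorn[OF po] ub by blast
  show ?thesis
    using m by (intro that[of m]) (auto simp: S_def)
qed

text \<open>Lowering \<open>p\<close> along \<open>w\<close> before passing to a minimal functional
  is what gives equality at \<open>w\<close>: \<open>f (- w) \<le> - p w\<close> means
  \<open>f w \<ge> p w\<close>.\<close>

lemma Hahn_Banach_sublinear:
  assumes p: "sublinear p"
  obtains f where "linear f" "\<And>u. f u \<le> p u" "f w = p w"
proof -
  obtain q where q: "sublinear q" "\<And>u. q u \<le> p u" "q (- w) \<le> - p w"
    using sublinear_decrease[OF p] by blast
  obtain f where f: "sublinear f" "f \<le> q" and min: "\<And>r. sublinear r \<Longrightarrow> r \<le> f \<Longrightarrow> r = f"
    using ex_minimal_sublinear[OF q(1)] by blast
  \<comment> \<open>Lowering \<open>f\<close> along \<open>u\<close> gives a sublinear functional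
    below \<open>f\<close>, which by minimality is \<open>f\<close> itself.\<close>
  have "f (- u) \<le> - f u" for u
    using sublinear_decrease[OF f(1), of u] min by (metis le_funI)
  then have lin: "linear f"
    by (rule sublinear_odd_linear[OF f(1)])
  have le: "f u \<le> p u" for u
    using f(2) q(2)[of u] le_funD[of f q u] by linarith
  have "f (- w) \<le> - p w"
    using f(2) q(3) le_funD[of f q "- w"] by linarith
  then have "f w = p w"
    using le[of w] linear_neg[OF lin, of w] by simp
  with lin le show ?thesis
    by (rule that)
qed

lemma Hahn_Banach_bounded:
  fixes p :: "'v::real_normed_vector \<Rightarrow> real"
  assumes p: "sublinear p" and bound: "\<And>u. p u \<le> M * norm u"
  obtains f :: "'v \<Rightarrow>\<^sub>L real" where "\<And>u. blinfun_apply f u \<le> p u" "blinfun_apply f w = p w"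
proof -
  obtain f where f: "linear f" "\<And>u. f u \<le> p u" "f w = p w"
    using Hahn_Banach_sublinear[OF p] by blast
  have "norm (f u) \<le> norm u * M" for u
    using f(2)[of u] f(2)[of "- u"] bound[of u] bound[of "- u"] linear_neg[OF f(1), of u]
    by (simp add: algebra_simps)
  then have "bounded_linear f"
    using f(1) by (intro bounded_linear_intro[of _ M]) (auto simp: linear_add linear_scale)
  then show ?thesis
    using f that[of "Blinfun f"] by (simp add: bounded_linear_Blinfun_apply)
qed

subsection \<open>Weak-star convergence\<close>

text \<open>The functionals \<open>v\<close> in the second hypothesis are those dominated by the
  limit superior of \<open>w n y\<close>; they play the part of weak-star cluster points. Each value
  of the limit superior is attained by one of them, so if \<open>z\<close> is the only one, the
  limit superior is \<open>z\<close> everywhere, and passing to \<open>- y\<close> settles the limit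
  inferior.\<close>

lemma weak_star_lim_by_cluster:
  fixes w :: "nat \<Rightarrow> 'a::real_normed_vector \<Rightarrow>\<^sub>L real"
  assumes bound: "\<And>n. norm (w n) \<le> M"
    and unique: "\<And>v. (\<And>y c. (\<forall>\<^sub>F n in sequentially. w n y \<le> c) \<Longrightarrow> blinfun_apply v y \<le> c) \<Longrightarrow> v = z"
  shows "weak_star_lim w z"
proof -
  \<comment> \<open>\<open>p y\<close> is the limit superior of \<open>w n y\<close>\<close>
  define C where "C y = {c. \<forall>\<^sub>F n in sequentially. w n y \<le> c}" for y
  define p where "p y = Inf (C y)" for y
  have wb: "\<bar>w n y\<bar> \<le> M * norm y" for n y
    using norm_blinfun[of "w n" y] mult_right_mono[OF bound[of n] norm_ge_zero[of y]] by simp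
  have bdd: "bdd_below (C y)" for y
  proof (rule bdd_belowI[of _ "- (M * norm y)"])
    fix c
    assume "c \<in> C y"
    then obtain n where "w n y \<le> c"
      by (auto simp: C_def eventually_sequentially)
    then show "- (M * norm y) \<le> c"
      using wb[of n y] by linarith
  qed
  have M: "M * norm y \<in> C y" for y
    unfolding C_def by (simp add: abs_le_D1[OF wb])
  have ne: "C y \<noteq> {}" for y
    using M by blast
  have le: "p y \<le> c" if "\<forall>\<^sub>F n in sequentially. w n y \<le> c" for y c
    unfolding p_def by (rule cInf_lower[OF _ bdd]) (use that in \<open>auto simp: C_def\<close>)
  have sub: "sublinear p"
  proof (rule sublinearI)
    fix u v
    have "p (u + v) \<le> a + b" if "a \<in> C u" "b \<in> C v" for a b
    proof (rule le)
      have "\<forall>\<^sub>F n in sequentially. w n u \<le> a" "\<forall>\<^sub>F n in sequentially. w n v \<le> b"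
        using that by (auto simp: C_def)
      then show "\<forall>\<^sub>F n in sequentially. w n (u + v) \<le> a + b"
        by eventually_elim (simp add: blinfun.add_right)
    qed
    then have "p (u + v) - b \<le> p u" if "b \<in> C v" for b
      unfolding p_def[of u] by (intro cInf_greatest[OF ne]) (use that in \<open>auto simp: algebra_simps\<close>)
    then have "p (u + v) - p u \<le> p v"
      unfolding p_def[of v] by (intro cInf_greatest[OF ne]) (auto simp: algebra_simps)
    then show "p (u + v) \<le> p u + p v"
      by simp
  next
    fix t :: real and u
    assume t: "t > 0"
    have "p (t *\<^sub>R u) \<le> t * a" if "a \<in> C u" for a
      by (rule le) (use that t in \<open>auto simp: C_def blinfun.scaleR_right elim!: eventually_mono\<close>)
    then have "p (t *\<^sub>R u) / t \<le> p u"
      unfolding p_def[of u] using t by (intro cInf_greatest[OF ne]) (auto simp: field_simps)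
    then show "p (t *\<^sub>R u) \<le> t * p u"
      using t by (simp add: field_simps)
  qed
  have "p y \<le> M * norm y" for y
    using le M by (auto simp: C_def)
  then have p: "p y = z y" for y
  proof -
    \<comment> \<open>The dominated functional is chosen for the given \<open>y\<close>, but
      uniqueness identifies it with \<open>z\<close> each time.\<close>
    obtain v :: "'a \<Rightarrow>\<^sub>L real" where v: "\<And>u. v u \<le> p u" "v y = p y"
      using Hahn_Banach_bounded[OF sub \<open>\<And>y. p y \<le> M * norm y\<close>, of y] by blast
    have "v u \<le> c" if "\<forall>\<^sub>F n in sequentially. w n u \<le> c" for u c
      using v(1)[of u] le[OF that] by linarith
    then have "v = z"
      by (rule unique)
    with v(2) show ?thesis
      by simp
  qed
  have upper: "\<forall>\<^sub>F n in sequentially. w n y < c" if "z y < c" for y c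
  proof -
    obtain a where "a \<in> C y" "a < c"
      using \<open>z y < c\<close> cInf_less_iff[OF ne bdd] p[of y] unfolding p_def by metis
    then show ?thesis
      by (auto simp: C_def elim!: eventually_mono)
  qed
  show ?thesis
    unfolding weak_star_lim_def
  proof (intro allI order_tendstoI)
    fix y a
    assume "a < z y"
    then show "\<forall>\<^sub>F n in sequentially. a < w n y"
      using upper[of "- y" "- a"] by (simp add: blinfun.minus_right)
  qed (rule upper)
qed

text \<open>Bounds slightly above the limit, used at \<open>y\<close> and at \<open>- y\<close>, pin
  down a dominated functional wherever the sequence converges.\<close>

lemma le_eventual_bounds_eq_lim:
  fixes w :: "nat \<Rightarrow> 'a::real_normed_vector \<Rightarrow>\<^sub>L real"
  assumes v: "\<And>y c. (\<forall>\<^sub>F n in sequentially. w n y \<le> c) \<Longrightarrow> blinfun_apply v y \<le> c"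
    and lim: "(\<lambda>n. w n y) \<longlonglongrightarrow> l"
  shows "v y = l"
proof (rule antisym)
  show "v y \<le> l"
  proof (rule dense_ge)
    fix c
    assume "l < c"
    then show "v y \<le> c"
      by (intro v eventually_mono[OF order_tendstoD(2)[OF lim]]) auto
  qed
  show "l \<le> v y"
  proof (rule dense_le)
    fix c
    assume "c < l"
    then have "v (- y) \<le> - c"
      by (intro v eventually_mono[OF order_tendstoD(1)[OF lim]]) (auto simp: blinfun.minus_right)
    then show "c \<le> v y"
      by (simp add: blinfun.minus_right)
  qed
qed

section \<open>Countable test sets for weak-star convergence of bounded sequences\<close>

text \<open>\<open>T\<close> consists of the finite rational combinations of \<open>S\<close>, coded
  by lists so that countability is that of \<open>lists\<close> and concatenation is addition. Real
  factors enter only in the closure, as limits of rational ones.\<close>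

lemma countable_dense_subspace:
  fixes S :: "'v::real_normed_vector set"
  assumes "countable S"
  obtains T where "countable T" "S \<subseteq> T" "subspace (closure T)"
proof -
  define comb where "comb l = (\<Sum>(q, s)\<leftarrow>l. of_rat q *\<^sub>R s)" for l :: "(rat \<times> 'v) list"
  define T where "T = comb ` lists (UNIV \<times> S)"
  have comb: "comb l \<in> T" if "l \<in> lists (UNIV \<times> S)" for l
    using that by (simp add: T_def)
  have "countable T"
    unfolding T_def using assms by (intro countable_image countable_lists countable_SIGMA) auto
  moreover have "S \<subseteq> T"
  proof
    fix s
    assume "s \<in> S"
    then show "s \<in> T"
      using comb[of "[(1, s)]"] by (simp add: comb_def)
  qed
  moreover have "subspace (closure T)"
  proof (rule subspaceI)
    have "0 \<in> T"
      using comb[of "[]"] by (simp add: comb_def)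
    then show "0 \<in> closure T"
      using closure_subset by blast
  next
    have add: "a + b \<in> T" if ab: "a \<in> T" "b \<in> T" for a b
    proof -
      obtain k l where kl: "k \<in> lists (UNIV \<times> S)" "a = comb k" "l \<in> lists (UNIV \<times> S)" "b = comb l"
        using ab unfolding T_def by blast
      then show ?thesis
        using comb[of "k @ l"] by (simp add: comb_def)
    qed
    fix a b
    assume "a \<in> closure T" "b \<in> closure T"
    then obtain f g where "\<And>n. f n \<in> T" "f \<longlonglongrightarrow> a" "\<And>n. g n \<in> T" "g \<longlonglongrightarrow> b"
      by (metis closure_sequential)
    then show "a + b \<in> closure T"
      unfolding closure_sequential by (intro exI[of _ "\<lambda>n. f n + g n"]) (auto intro: add tendsto_add)
  next
    have scale: "of_rat q *\<^sub>R a \<in> T" if a: "a \<in> T" for q a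
    proof -
      obtain l where l: "l \<in> lists (UNIV \<times> S)" "a = comb l"
        using a unfolding T_def by blast
      have "comb (map (\<lambda>(r, s). (q * r, s)) l) = of_rat q *\<^sub>R comb l"
        by (induction l) (auto simp: comb_def of_rat_mult scaleR_add_right)
      moreover have "map (\<lambda>(r, s). (q * r, s)) l \<in> lists (UNIV \<times> S)"
        using l(1) by (auto simp: in_lists_conv_set)
      ultimately show ?thesis
        using l(2) comb by metis
    qed
    fix c :: real and a
    assume "a \<in> closure T"
    then obtain f where f: "\<And>n. f n \<in> T" "f \<longlonglongrightarrow> a"
      by (metis closure_sequential)
    have "c \<in> closure \<rat>"
      by (simp add: Rats_closure_real)
    then obtain r where r: "\<And>n. r n \<in> \<rat>" "r \<longlonglongrightarrow> c"
      by (metis closure_sequential)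
    have "r n *\<^sub>R f n \<in> T" for n
      using r(1)[of n] scale[OF f(1)[of n]] by (auto elim: Rats_cases)
    then show "c *\<^sub>R a \<in> closure T"
      unfolding closure_sequential using tendsto_scaleR[OF r(2) f(2)]
      by (intro exI[of _ "\<lambda>n. r n *\<^sub>R f n"]) auto
  qed
  ultimately show ?thesis
    by (rule that)
qed

text \<open>Competitors \<open>a\<close> and \<open>b\<close> in \<open>V\<close> for
  \<open>u\<close> and \<open>v\<close> yield the competitor \<open>a + b\<close> for
  \<open>u + v\<close>, and likewise for multiples. A linear functional dominated by this distance
  vanishes on \<open>V\<close>.\<close>

lemma sublinear_infdist:
  fixes V :: "'v::real_normed_vector set"
  assumes V: "subspace V"
  shows "sublinear (\<lambda>u. infdist u V)"
proof -
  have ne: "V \<noteq> {}"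
    using subspace_0[OF V] by blast
  show ?thesis
  proof (rule sublinearI)
    fix u v
    have le: "infdist (u + v) V \<le> dist u a + dist v b" if "a \<in> V" "b \<in> V" for a b
      using infdist_le[OF subspace_add[OF V that], of "u + v"] dist_triangle_add[of u v a b]
      by linarith
    have "infdist (u + v) V - dist v b \<le> infdist u V" if "b \<in> V" for b
      unfolding infdist_notempty[OF ne, of u]
      by (rule cINF_greatest[OF ne]) (use le that in \<open>auto simp: algebra_simps\<close>)
    then have "infdist (u + v) V - infdist u V \<le> infdist v V"
      unfolding infdist_notempty[OF ne, of v]
      by (intro cINF_greatest[OF ne]) (auto simp: algebra_simps)
    then show "infdist (u + v) V \<le> infdist u V + infdist v V"
      by simp
  next
    fix t :: real and u
    assume t: "t > 0"
    have "infdist (t *\<^sub>R u) V / t \<le> dist u a" if "a \<in> V" for a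
    proof -
      have "dist (t *\<^sub>R u) (t *\<^sub>R a) = dist u a * t"
        using t by (simp add: dist_norm flip: scaleR_diff_right)
      then show ?thesis
        using infdist_le[OF subspace_scale[OF V that], of "t *\<^sub>R u" t] t
        by (simp add: pos_divide_le_eq)
    qed
    then have "infdist (t *\<^sub>R u) V / t \<le> infdist u V"
      unfolding infdist_notempty[OF ne, of u] by (intro cINF_greatest[OF ne]) auto
    then show "infdist (t *\<^sub>R u) V \<le> t * infdist u V"
      using t by (simp add: field_simps)
  qed
qed

text \<open>Hahn-Banach below the distance to \<open>V\<close> gives a functional on the dual that
  vanishes on \<open>V\<close> and takes at \<open>v\<close> the positive distance; reflexivity
  makes it evaluation at some \<open>y\<close>.\<close>

lemma reflexive_separation:
  fixes V :: "('a::real_normed_vector \<Rightarrow>\<^sub>L real) set"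
  assumes refl: "reflexive_space TYPE('a)" and V: "subspace V" "closed V" and v: "v \<notin> V"
  obtains y where "\<And>u. u \<in> V \<Longrightarrow> blinfun_apply u y = 0" "v y \<noteq> 0"
proof -
  have "infdist u V \<le> 1 * norm u" for u
    using infdist_le[OF subspace_0[OF V(1)], of u] by simp
  then obtain f :: "('a \<Rightarrow>\<^sub>L real) \<Rightarrow>\<^sub>L real"
    where f: "\<And>u. f u \<le> infdist u V" "f v = infdist v V"
    using Hahn_Banach_bounded[OF sublinear_infdist[OF V(1)]] by blast
  obtain y where y: "\<And>u. f u = u y"
    using refl unfolding reflexive_space_def by blast
  have "u y = 0" if "u \<in> V" for u
    using f(1)[of u] f(1)[of "- u"] that subspace_neg[OF V(1) that] y[of u] y[of "- u"]
    by (simp add: blinfun.minus_left)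
  moreover have "v y \<noteq> 0"
    using f(2) y[of v] infdist_pos_not_in_closed[OF V(2) _ v] subspace_0[OF V(1)] by force
  ultimately show ?thesis
    by (rule that)
qed

text \<open>Otherwise half the norm of \<open>u\<close> would already bound
  \<open>u\<close>.\<close>

lemma ex_almost_norming:
  fixes u :: "'a::real_normed_vector \<Rightarrow>\<^sub>L real"
  assumes "u \<noteq> 0"
  obtains d where "norm u / 2 * norm d < \<bar>u d\<bar>"
proof -
  have "\<not> (\<forall>d. norm (u d) \<le> norm u / 2 * norm d)"
    using norm_blinfun_bound[of "norm u / 2" u] assms by fastforce
  then show ?thesis
    using that by (auto simp: not_le)
qed

text \<open>One almost norming vector for each member of \<open>T\<close> suffices. If
  \<open>v\<close> vanishes at all of them and \<open>u\<close> in \<open>T\<close> is near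
  \<open>v\<close>, then \<open>u (d u) = (u - v) (d u)\<close> is too small for an almost norming
  vector of \<open>u\<close>.\<close>

lemma ex_countable_separating:
  fixes T :: "('a::real_normed_vector \<Rightarrow>\<^sub>L real) set"
  assumes "countable T"
  obtains D where "countable D" "\<And>v. v \<in> closure T \<Longrightarrow> (\<And>d. d \<in> D \<Longrightarrow> blinfun_apply v d = 0) \<Longrightarrow> v = 0"
proof -
  have "\<exists>d. u \<noteq> 0 \<longrightarrow> norm u / 2 * norm d < \<bar>blinfun_apply u d\<bar>" for u :: "'a \<Rightarrow>\<^sub>L real"
    using ex_almost_norming by metis
  then obtain d where d: "\<And>u :: 'a \<Rightarrow>\<^sub>L real. u \<noteq> 0 \<Longrightarrow> norm u / 2 * norm (d u) < \<bar>blinfun_apply u (d u)\<bar>"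
    by metis
  show ?thesis
  proof
    show "countable (d ` T)"
      using assms by simp
    fix v
    assume v: "v \<in> closure T" and zero: "\<And>y. y \<in> d ` T \<Longrightarrow> blinfun_apply v y = 0"
    show "v = 0"
    proof (rule ccontr)
      assume "v \<noteq> 0"
      \<comment> \<open>With one third, \<open>norm u\<close> exceeds two thirds of
        \<open>norm v\<close>, so half of it still exceeds \<open>dist u v\<close>.\<close>
      then obtain u where u: "u \<in> T" "dist u v < norm v / 3"
        using v unfolding closure_approachable by (meson divide_pos_pos zero_less_norm_iff zero_less_numeral)
      have "norm v \<le> norm u + dist u v"
        using norm_triangle_sub[of v u] by (simp add: dist_norm norm_minus_commute)
      then have large: "dist u v < norm u / 2"
        using u(2) by simp
      then have "norm u / 2 * norm (d u) < \<bar>u (d u)\<bar>"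
        by (intro d) auto
      also have "\<dots> = \<bar>(u - v) (d u)\<bar>"
        using zero u(1) by (simp add: blinfun.diff_left)
      also have "\<dots> \<le> dist u v * norm (d u)"
        using norm_blinfun[of "u - v" "d u"] by (simp add: dist_norm)
      finally show False
        using large mult_right_mono[of "dist u v" "norm u / 2" "norm (d u)"] by simp
    qed
  qed
qed

text \<open>\<open>D\<close> depends on \<open>S\<close> alone and is fixed before \<open>w\<close>.
  The diagonal construction can therefore control finitely many members of \<open>D\<close> at each
  stage and apply the test to its outcome afterwards.\<close>

lemma weak_star_countable_test:
  fixes S :: "('a::real_normed_vector \<Rightarrow>\<^sub>L real) set"
  assumes space: "reflexive_space TYPE('a) \<or> separable_space (euclidean :: 'a topology)"
    and S: "countable S"
  obtains D where "countable D" "D \<noteq> {}"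
    "\<And>w z. range w \<subseteq> S \<Longrightarrow> z \<in> S \<Longrightarrow> Bseq w \<Longrightarrow>
       (\<And>d. d \<in> D \<Longrightarrow> (\<lambda>n. blinfun_apply (w n) d) \<longlonglongrightarrow> blinfun_apply z d) \<Longrightarrow> weak_star_lim w z"
  using space
proof
  assume "separable_space (euclidean :: 'a topology)"
  then obtain D :: "'a set" where D: "countable D" "closure D = UNIV"
    by (auto simp: separable_space_def)
  show ?thesis
  proof (rule that[OF D(1)])
    show "D \<noteq> {}"
      using D(2) by auto
    fix w :: "nat \<Rightarrow> 'a \<Rightarrow>\<^sub>L real" and z :: "'a \<Rightarrow>\<^sub>L real"
    assume bseq: "Bseq w" and lim: "\<And>d. d \<in> D \<Longrightarrow> (\<lambda>n. w n d) \<longlonglongrightarrow> z d"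
    obtain M where M: "\<And>n. norm (w n) \<le> M"
      using bseq by (metis Bseq_def)
    show "weak_star_lim w z"
    proof (rule weak_star_lim_by_cluster[OF M])
      fix v
      assume v: "\<And>y c. (\<forall>\<^sub>F n in sequentially. w n y \<le> c) \<Longrightarrow> blinfun_apply v y \<le> c"
      have eq: "v d = z d" if "d \<in> D" for d
        using v lim[OF that] by (rule le_eventual_bounds_eq_lim)
      have "closed {y. v y = z y}"
        by (intro closed_Collect_eq continuous_intros)
      then have "closure D \<subseteq> {y. v y = z y}"
        using eq by (intro closure_minimal) auto
      then show "v = z"
        using D(2) by (intro blinfun_eqI) auto
    qed
  qed
next
  assume refl: "reflexive_space TYPE('a)"
  obtain T where T: "countable T" "S \<subseteq> T" "subspace (closure T)"
    using countable_dense_subspace[OF S] .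
  obtain D where D: "countable D"
      "\<And>v. v \<in> closure T \<Longrightarrow> (\<And>d. d \<in> D \<Longrightarrow> blinfun_apply v d = 0) \<Longrightarrow> v = 0"
    using ex_countable_separating[OF T(1)] by blast
  show ?thesis
  \<comment> \<open>Inserting 0 makes the set nonempty at no cost, as all functionals vanish
    there.\<close>
  proof (rule that[of "insert 0 D"])
    show "countable (insert 0 D)"
      using D(1) by simp
    fix w :: "nat \<Rightarrow> 'a \<Rightarrow>\<^sub>L real" and z :: "'a \<Rightarrow>\<^sub>L real"
    assume w: "range w \<subseteq> S" and z: "z \<in> S" and bseq: "Bseq w"
      and lim: "\<And>d. d \<in> insert 0 D \<Longrightarrow> (\<lambda>n. w n d) \<longlonglongrightarrow> z d"
    have mem: "u \<in> closure T" if "u \<in> S" for u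
      using that T(2) closure_subset by blast
    obtain M where M: "\<And>n. norm (w n) \<le> M"
      using bseq by (metis Bseq_def)
    show "weak_star_lim w z"
    proof (rule weak_star_lim_by_cluster[OF M])
      fix v
      assume v: "\<And>y c. (\<forall>\<^sub>F n in sequentially. w n y \<le> c) \<Longrightarrow> blinfun_apply v y \<le> c"
      \<comment> \<open>A separating \<open>y\<close> annihilates every \<open>w n\<close>, so the
        dominated functional \<open>v\<close> would vanish at \<open>y\<close> too.\<close>
      have "v \<in> closure T"
      proof (rule ccontr)
        assume "v \<notin> closure T"
        then obtain y where y: "\<And>u. u \<in> closure T \<Longrightarrow> blinfun_apply u y = 0" "v y \<noteq> 0"
          using reflexive_separation[OF refl T(3) closed_closure] by blast
        have "w n y = 0" for n
          using w by (intro y(1) mem) auto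
        then have "(\<lambda>n. w n y) \<longlonglongrightarrow> 0"
          by simp
        with v have "v y = 0"
          by (rule le_eventual_bounds_eq_lim)
        with y(2) show False ..
      qed
      then have "v - z \<in> closure T"
        using mem[OF z] by (rule subspace_diff[OF T(3)])
      moreover have "(v - z) d = 0" if "d \<in> D" for d
        using le_eventual_bounds_eq_lim[OF v lim, of d] that by (simp add: blinfun.diff_left)
      ultimately have "v - z = 0"
        by (rule D(2))
      then show "v = z"
        by simp
    qed
  qed simp
qed

subsection \<open>Recovery sequences\<close>

text \<open>At \<open>n\<close> the largest index \<open>m \<le> n\<close> whose condition already
  holds there is used; antitonicity passes the condition down to every smaller index.\<close>

lemma diagonal_sequence:
  fixes P :: "nat \<Rightarrow> nat \<Rightarrow> 'b \<Rightarrow> bool"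
  assumes ex: "\<And>m. \<exists>u. \<forall>\<^sub>F n in sequentially. P m n (u n)"
    and anti: "\<And>n v. antimono (\<lambda>m. P m n v)"
  shows "\<exists>w. \<forall>m. \<forall>\<^sub>F n in sequentially. P m n (w n)"
proof -
  obtain u where u: "\<And>m. \<forall>\<^sub>F n in sequentially. P m n (u m n)"
    using ex by metis
  define I where "I n = {m. m \<le> n \<and> P m n (u m n)}" for n
  \<comment> \<open>\<open>I n\<close> is empty for at most finitely many \<open>n\<close>, since
    eventually it contains 0; the unspecified maximum there does not affect eventual
    statements.\<close>
  define w where "w n = u (Max (I n)) n" for n
  have "\<forall>\<^sub>F n in sequentially. P m n (w n)" for m
    using u[of m] eventually_ge_at_top[of m]
  proof eventually_elim
    case (elim n)
    have "finite (I n)"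
      by (rule finite_subset[of _ "{..n}"]) (auto simp: I_def)
    moreover have "m \<in> I n"
      using elim by (simp add: I_def)
    ultimately have "Max (I n) \<in> I n" "m \<le> Max (I n)"
      by (auto intro: Max_in Max_ge)
    then show ?case
      using antimonoD[OF anti, of m "Max (I n)" n "w n"] by (simp add: I_def w_def)
  qed
  then show ?thesis
    by blast
qed

section \<open>Second subderivatives as lower bounds for difference quotients\<close>

lemma second_subderiv_le_liminf:
  assumes "pos_decreasing_null t" "weak_star_lim zs z"
  shows "second_subderiv j x g z \<le> liminf (\<lambda>n. second_quot j x g (t n) (zs n))"
  unfolding second_subderiv_def by (rule Inf_lower) (use assms in auto)

lemma tendsto_imp_weak_star_lim:
  assumes "zs \<longlonglongrightarrow> z"
  shows "weak_star_lim zs z"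
  unfolding weak_star_lim_def using assms by (intro allI tendsto_intros)

lemma weak_star_lim_const: "weak_star_lim (\<lambda>_. z) z"
  by (simp add: weak_star_lim_def)

lemma tendsto_dist_lt_inverse:
  assumes "\<And>m :: nat. \<forall>\<^sub>F n in F. dist (f n) l < 1 / (real m + 1)"
  shows "(f \<longlongrightarrow> l) F"
proof (rule tendstoI)
  fix e :: real
  assume "e > 0"
  then obtain m :: nat where "1 / (real m + 1) < e"
    using nat_approx_posE[of e] by (metis Suc_eq_plus1 of_nat_Suc add.commute)
  with assms[of m] show "\<forall>\<^sub>F n in F. dist (f n) l < e"
    by (auto elim!: eventually_mono)
qed

text \<open>
  A recovery sequence that meets each upper tolerance eventually already converges, because the
  second subderivative is a lower bound for the limit inferior.
\<close>
lemma recovery_limit: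
  assumes t: "pos_decreasing_null t" and zs: "weak_star_lim zs z"
    and lower: "ereal q \<le> second_subderiv j x g z"
    and upper: "\<And>m :: nat. \<forall>\<^sub>F n in sequentially.
                  second_quot j x g (t n) (zs n) < ereal (q + 1 / (real m + 1))"
  shows "second_subderiv j x g z = ereal q"
    and "(\<lambda>n. second_quot j x g (t n) (zs n)) \<longlonglongrightarrow> ereal q"
proof -
  let ?f = "\<lambda>n. second_quot j x g (t n) (zs n)"
  have ge: "second_subderiv j x g z \<le> liminf ?f"
    using t zs by (rule second_subderiv_le_liminf)
  have bound: "limsup ?f \<le> ereal (q + 1 / (real m + 1))" for m
    by (rule Limsup_bounded) (use upper[of m] in \<open>auto elim!: eventually_mono intro: less_imp_le\<close>)
  have "(\<lambda>m. q + 1 / (real m + 1)) \<longlonglongrightarrow> q + 0"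
    by (intro tendsto_intros) (use LIMSEQ_inverse_real_of_nat in \<open>simp add: inverse_eq_divide add.commute\<close>)
  then have "(\<lambda>m. ereal (q + 1 / (real m + 1))) \<longlonglongrightarrow> ereal q"
    by simp
  then have le: "limsup ?f \<le> ereal q"
    by (rule LIMSEQ_le_const) (use bound in blast)
  have mid: "liminf ?f \<le> limsup ?f"
    by (rule Liminf_le_Limsup) simp
  \<comment> \<open>The chain from \<open>q\<close> through the second subderivative, the limit
    inferior and the limit superior ends at \<open>q\<close> again.\<close>
  show "second_subderiv j x g z = ereal q"
    using ge le mid lower by order
  have "liminf ?f = ereal q" "limsup ?f = ereal q"
    using ge le mid lower by order+
  then show "?f \<longlonglongrightarrow> ereal q"
    by (intro Liminf_eq_Limsup) auto
qed

section \<open>Diagonal recovery sequences\<close>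

lemma frequently_of_liminf_le:
  fixes a :: "nat \<Rightarrow> ereal"
  assumes "liminf a \<le> c" "c < d" "\<forall>\<^sub>F k in sequentially. P k"
  obtains k where "a k < d" "P k"
proof -
  have "\<exists>\<^sub>F k in sequentially. a k < d"
  proof (rule ccontr)
    assume "\<not> (\<exists>\<^sub>F k in sequentially. a k < d)"
    then have "d \<le> liminf a"
      by (intro Liminf_bounded) (simp add: not_frequently not_less)
    with assms(1,2) show False
      by order
  qed
  then have "\<exists>\<^sub>F k in sequentially. P k \<and> a k < d"
    using assms(3) by (rule frequently_eventually_conj)
  then show ?thesis
    using that by (auto dest: frequently_ex)
qed

text \<open>The common core of the weak-star and the norm case, with \<open>close m\<close> standing
  for the m-th neighbourhood of the target. Membership of \<open>w n\<close> in the ranges is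
  recorded so that the result stays in a countable set chosen beforehand.\<close>

lemma recovery_diagonal:
  fixes f :: "nat \<Rightarrow> 'b \<Rightarrow> ereal"
    and close :: "nat \<Rightarrow> 'b \<Rightarrow> bool"
  assumes lim: "liminf (\<lambda>k. ereal (q k)) \<le> ereal q0"
    and close_anti: "\<And>v. antimono (\<lambda>m. close m v)"
    and close: "\<And>m. \<forall>\<^sub>F k in sequentially. \<forall>\<^sub>F n in sequentially. close m (zs k n)"
    and conv: "\<And>k. (\<lambda>n. f n (zs k n)) \<longlonglongrightarrow> ereal (q k)"
  shows "\<exists>w. (\<forall>n. w n \<in> (\<Union>k. range (zs k))) \<and>
    (\<forall>m. \<forall>\<^sub>F n in sequentially. close m (w n)) \<and>
    (\<forall>m. \<forall>\<^sub>F n in sequentially. f n (w n) < ereal (q0 + 1 / (real m + 1)))"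
proof -
  define P where
    "P m n v \<longleftrightarrow> close m v \<and> f n v < ereal (q0 + 1 / (real m + 1)) \<and> v \<in> (\<Union>k. range (zs k))" for m n v
  have ex: "\<exists>u. \<forall>\<^sub>F n in sequentially. P m n (u n)" for m
  proof -
    have "ereal q0 < ereal (q0 + 1 / (real m + 1))"
      by simp
    \<comment> \<open>The limit inferior puts \<open>q k\<close> below the tolerance for infinitely
      many \<open>k\<close>, and closeness holds for almost all \<open>k\<close>, so a single
      \<open>k\<close> serves both.\<close>
    with lim obtain k where k: "ereal (q k) < ereal (q0 + 1 / (real m + 1))"
        "\<forall>\<^sub>F n in sequentially. close m (zs k n)"
      using close[of m] by (rule frequently_of_liminf_le)
    have "\<forall>\<^sub>F n in sequentially. P m n (zs k n)"
      using order_tendstoD(2)[OF conv k(1)] k(2) by eventually_elim (auto simp: P_def)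
    then show ?thesis
      by blast
  qed
  have anti: "antimono (\<lambda>m. P m n v)" for n v
  proof (rule antimonoI)
    fix k m :: nat
    assume "k \<le> m"
    then have "ereal (q0 + 1 / (real m + 1)) \<le> ereal (q0 + 1 / (real k + 1))"
      by (simp add: divide_left_mono)
    moreover have "close m v \<Longrightarrow> close k v"
      using antimonoD[OF close_anti \<open>k \<le> m\<close>, of v] by (simp add: le_bool_def)
    ultimately show "P m n v \<le> P k n v"
      unfolding P_def by (auto intro: less_le_trans)
  qed
  obtain w where w: "\<And>m. \<forall>\<^sub>F n in sequentially. P m n (w n)"
    using diagonal_sequence[of P, OF ex anti] by blast
  \<comment> \<open>modify the finitely many terms at which \<open>P 0\<close> may fail\<close>
  define w' where "w' n = (if P 0 n (w n) then w n else zs 0 0)" for n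
  have w': "\<forall>\<^sub>F n in sequentially. P m n (w' n)" for m
    using w[of m] w[of 0] by eventually_elim (simp add: w'_def)
  show ?thesis
  proof (intro exI[of _ w'] conjI allI)
    show "w' n \<in> (\<Union>k. range (zs k))" for n
      unfolding w'_def by (cases "P 0 n (w n)") (simp add: P_def, auto)
    show "\<forall>\<^sub>F n in sequentially. close m (w' n)" for m
      using w'[of m] by eventually_elim (simp add: P_def)
    show "\<forall>\<^sub>F n in sequentially. f n (w' n) < ereal (q0 + 1 / (real m + 1))" for m
      using w'[of m] by eventually_elim (simp add: P_def)
  qed
qed

lemma Bseq_of_norm_tendsto: "(\<lambda>n. norm (w n)) \<longlonglongrightarrow> l \<Longrightarrow> Bseq w"
  using convergent_imp_Bseq[of "\<lambda>n. norm (w n)"] by (auto simp: convergent_def Bseq_def)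

text \<open>At level \<open>m\<close> the diagonal controls the norm and the test vectors
  \<open>d 0\<close> to \<open>d m\<close>. Convergence of the norms provides the boundedness that
  the countable test requires.\<close>

lemma weak_star_recovery:
  fixes z :: "'a::real_normed_vector \<Rightarrow>\<^sub>L real" and zk :: "nat \<Rightarrow> 'a \<Rightarrow>\<^sub>L real"
  assumes space: "reflexive_space TYPE('a) \<or> separable_space (euclidean :: 'a topology)"
    and zk: "weak_star_lim zk z" "(\<lambda>k. norm (zk k)) \<longlonglongrightarrow> norm z"
    and q: "liminf (\<lambda>k. ereal (q k)) \<le> ereal q0"
    and zs: "\<And>k. weak_star_lim (zs k) (zk k)" "\<And>k. (\<lambda>n. norm (zs k n)) \<longlonglongrightarrow> norm (zk k)"
    and conv: "\<And>k. (\<lambda>n. f n (zs k n)) \<longlonglongrightarrow> ereal (q k)"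
  obtains w where "weak_star_lim w z" "(\<lambda>n. norm (w n)) \<longlonglongrightarrow> norm z"
    "\<And>m. \<forall>\<^sub>F n in sequentially. f n (w n) < ereal (q0 + 1 / (real m + 1))"
proof -
  define S where "S = insert z (\<Union>k. range (zs k))"
  have "countable S"
    by (simp add: S_def)
  with space obtain D where D: "countable D" "D \<noteq> {}" and
    test: "\<And>w z. range w \<subseteq> S \<Longrightarrow> z \<in> S \<Longrightarrow> Bseq w \<Longrightarrow>
       (\<And>d. d \<in> D \<Longrightarrow> (\<lambda>n. blinfun_apply (w n) d) \<longlonglongrightarrow> blinfun_apply z d) \<Longrightarrow> weak_star_lim w z"
    by (rule weak_star_countable_test) blast
  define d where "d = from_nat_into D"
  define close where
    "close m v \<longleftrightarrow> dist (norm v) (norm z) < 1 / (real m + 1) \<and>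
       (\<forall>i\<le>m. dist (blinfun_apply v (d i)) (z (d i)) < 1 / (real m + 1))" for m v
  have close: "\<forall>\<^sub>F k in sequentially. \<forall>\<^sub>F n in sequentially. close m (zs k n)" for m
  proof -
    have ev: "\<forall>\<^sub>F n in sequentially. close m (v n)"
      if "\<forall>\<^sub>F n in sequentially. dist (norm (v n)) (norm z) < 1 / (real m + 1)"
         "\<And>i. i \<le> m \<Longrightarrow>
            \<forall>\<^sub>F n in sequentially. dist (blinfun_apply (v n) (d i)) (z (d i)) < 1 / (real m + 1)"
      for v
    proof -
      have "\<forall>\<^sub>F n in sequentially. \<forall>i\<in>{..m}. dist (blinfun_apply (v n) (d i)) (z (d i)) < 1 / (real m + 1)"
        using that(2) by (intro eventually_ball_finite) auto
      with that(1) show ?thesis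
        by eventually_elim (auto simp: close_def)
    qed
    have "\<forall>\<^sub>F k in sequentially. close m (zk k)"
      using zk by (intro ev tendstoD) (auto simp: weak_star_lim_def)
    then show ?thesis
    proof eventually_elim
      case (elim k)
      \<comment> \<open>\<open>zk k\<close> meets the strict tolerance, so sequences converging to
        it eventually meet the same tolerance.\<close>
      have lim: "\<forall>\<^sub>F n in sequentially. dist (a n) b < e"
        if "a \<longlonglongrightarrow> c" "dist c b < e" for a :: "nat \<Rightarrow> real" and b c e
        by (rule order_tendstoD(2)[OF tendsto_dist[OF that(1) tendsto_const] that(2)])
      have pt: "(\<lambda>n. blinfun_apply (zs k n) (d i)) \<longlonglongrightarrow> zk k (d i)" for i
        using zs(1) by (simp add: weak_star_lim_def)
      show ?case
      proof (rule ev)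
        show "\<forall>\<^sub>F n in sequentially. dist (norm (zs k n)) (norm z) < 1 / (real m + 1)"
          using zs(2) by (rule lim) (use elim in \<open>simp add: close_def\<close>)
        show "\<forall>\<^sub>F n in sequentially. dist (blinfun_apply (zs k n) (d i)) (z (d i)) < 1 / (real m + 1)"
          if "i \<le> m" for i
          using pt by (rule lim) (use elim that in \<open>simp add: close_def\<close>)
      qed
    qed
  qed
  have anti: "antimono (\<lambda>m. close m v)" for v
  proof (intro antimonoI le_boolI)
    fix l m :: nat
    assume le: "l \<le> m" and c: "close m v"
    have "1 / (real m + 1) \<le> 1 / (real l + 1)"
      using le by (simp add: divide_left_mono)
    with le c show "close l v"
      unfolding close_def by (meson less_le_trans order_trans)
  qed
  obtain w where w: "\<And>n. w n \<in> (\<Union>k. range (zs k))"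
      "\<And>m. \<forall>\<^sub>F n in sequentially. close m (w n)"
      "\<And>m. \<forall>\<^sub>F n in sequentially. f n (w n) < ereal (q0 + 1 / (real m + 1))"
    using recovery_diagonal[where zs = zs and f = f and close = close, OF q anti close conv] by blast
  have norm: "(\<lambda>n. norm (w n)) \<longlonglongrightarrow> norm z"
    using w(2) by (intro tendsto_dist_lt_inverse) (simp add: close_def eventually_conj_iff)
  have "weak_star_lim w z"
  proof (rule test)
    show "range w \<subseteq> S"
      using w(1) unfolding S_def by blast
    show "z \<in> S"
      by (simp add: S_def)
    show "Bseq w"
      using norm by (rule Bseq_of_norm_tendsto)
    fix y
    assume "y \<in> D"
    then obtain i where y: "y = d i"
      using D from_nat_into_surj unfolding d_def by metis
    have "\<forall>\<^sub>F n in sequentially. dist (w n y) (z y) < 1 / (real m + 1)" for m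
      \<comment> \<open>The level must reach \<open>i\<close> for \<open>d i\<close> to be tested
        and \<open>m\<close> for the tolerance to be small enough.\<close>
      using w(2)[of "max i m"]
    proof eventually_elim
      case (elim n)
      then have "dist (w n y) (z y) < 1 / (real (max i m) + 1)"
        by (simp add: close_def y)
      also have "\<dots> \<le> 1 / (real m + 1)"
        by (intro divide_left_mono) auto
      finally show ?case .
    qed
    then show "(\<lambda>n. w n y) \<longlonglongrightarrow> z y"
      by (rule tendsto_dist_lt_inverse)
  qed
  then show ?thesis
    using norm w(3) by (rule that)
qed

text \<open>The same diagonal argument, with shrinking balls around \<open>z\<close> as
  neighbourhoods.\<close>

lemma strong_recovery:
  fixes z :: "'b::metric_space"
  assumes zk: "zk \<longlonglongrightarrow> z"
    and q: "liminf (\<lambda>k. ereal (q k)) \<le> ereal q0"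
    and zs: "\<And>k. zs k \<longlonglongrightarrow> zk k"
    and conv: "\<And>k. (\<lambda>n. f n (zs k n)) \<longlonglongrightarrow> ereal (q k)"
  obtains w where "w \<longlonglongrightarrow> z"
    "\<And>m. \<forall>\<^sub>F n in sequentially. f n (w n) < ereal (q0 + 1 / (real m + 1))"
proof -
  define close where "close m v \<longleftrightarrow> dist v z < 1 / (real m + 1)" for m v
  have close: "\<forall>\<^sub>F k in sequentially. \<forall>\<^sub>F n in sequentially. close m (zs k n)" for m
  proof -
    have "\<forall>\<^sub>F k in sequentially. dist (zk k) z < 1 / (real m + 1)"
      using zk by (rule tendstoD) simp
    then show ?thesis
    proof eventually_elim
      case (elim k)
      then show ?case
        unfolding close_def by (rule order_tendstoD(2)[OF tendsto_dist[OF zs tendsto_const]])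
    qed
  qed
  have anti: "antimono (\<lambda>m. close m v)" for v
  proof (intro antimonoI le_boolI)
    fix l m :: nat
    assume le: "l \<le> m" and c: "close m v"
    have "1 / (real m + 1) \<le> 1 / (real l + 1)"
      using le by (simp add: divide_left_mono)
    with le c show "close l v"
      unfolding close_def by (meson less_le_trans order_trans)
  qed
  obtain w where w: "\<And>n. w n \<in> (\<Union>k. range (zs k))"
      "\<And>m. \<forall>\<^sub>F n in sequentially. close m (w n)"
      "\<And>m. \<forall>\<^sub>F n in sequentially. f n (w n) < ereal (q0 + 1 / (real m + 1))"
    using recovery_diagonal[where zs = zs and f = f and close = close, OF q anti close conv] by blast
  have "w \<longlonglongrightarrow> z"
    by (rule tendsto_dist_lt_inverse) (use w(2) in \<open>simp add: close_def\<close>)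
  then show ?thesis
    using w(3) by (rule that)
qed

text \<open>Off the critical set the second subderivative is infinite and forces the quotients to
  infinity along every weak-star convergent sequence, in particular along the constant one.\<close>

lemma second_quot_const_tendsto:
  assumes "pos_decreasing_null t" "z \<notin> critical_set j x g"
  shows "(\<lambda>n. second_quot j x g (t n) z) \<longlonglongrightarrow> second_subderiv j x g z"
proof -
  have "second_subderiv j x g z = \<infinity>"
    using assms(2) by (simp add: critical_set_def)
  moreover from this have "liminf (\<lambda>n. second_quot j x g (t n) z) = \<infinity>"
    using second_subderiv_le_liminf[OF assms(1) weak_star_lim_const, of j x g z] by simp
  ultimately show ?thesis
    by (simp add: Liminf_PInfty)
qed

section \<open>Identification of \<open>Q\<close> and twice epi-differentiability\<close>

theorem lemma3p2:
  fixes j :: "('a::banach \<Rightarrow>\<^sub>L real) \<Rightarrow> ereal"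
    and x :: "'a \<Rightarrow>\<^sub>L real" and g :: 'a
    and Z :: "('a \<Rightarrow>\<^sub>L real) set"
    and Q :: "('a \<Rightarrow>\<^sub>L real) \<Rightarrow> real"
  assumes space: "reflexive_space TYPE('a) \<or> separable_space (euclidean :: 'a topology)"
    and proper: "proper_fun j"
    and x: "x \<in> effective_dom j"
    and g: "g \<in> subdifferential j x"
    and Z: "Z \<subseteq> critical_set j x g"
    and Q: "\<And>z. z \<in> critical_set j x g \<Longrightarrow> Q z \<ge> 0"
    and i: "\<And>z. z \<in> critical_set j x g \<Longrightarrow> second_subderiv j x g z \<ge> ereal (Q z)"
    and ii: "\<And>z t. z \<in> Z \<Longrightarrow> pos_decreasing_null t \<Longrightarrow>
               \<exists>zs. weak_star_lim zs z \<and> (\<lambda>n. norm (zs n)) \<longlonglongrightarrow> norm z \<and>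
                    (\<lambda>n. second_quot j x g (t n) (zs n)) \<longlonglongrightarrow> ereal (Q z)"
    and iii: "\<And>z. z \<in> critical_set j x g \<Longrightarrow>
               \<exists>zs. (\<forall>k. zs k \<in> Z) \<and> weak_star_lim zs z \<and> (\<lambda>k. norm (zs k)) \<longlonglongrightarrow> norm z \<and>
                    ereal (Q z) \<ge> liminf (\<lambda>k. ereal (Q (zs k)))"
  shows "(\<forall>z\<in>critical_set j x g. ereal (Q z) = second_subderiv j x g z) \<and>
         strictly_twice_epi_diff j x g \<and>
         ((\<forall>z\<in>Z. \<forall>t. pos_decreasing_null t \<longrightarrow>
             (\<exists>zs. zs \<longlonglongrightarrow> z \<and>
                   (\<lambda>n. second_quot j x g (t n) (zs n)) \<longlonglongrightarrow> ereal (Q z))) \<and>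
          (\<forall>z\<in>critical_set j x g.
             \<exists>zs. (\<forall>k. zs k \<in> Z) \<and> zs \<longlonglongrightarrow> z \<and>
                  ereal (Q z) \<ge> liminf (\<lambda>k. ereal (Q (zs k))))
          \<longrightarrow> strongly_twice_epi_diff j x g)"
proof -
  have weak: "\<exists>w. weak_star_lim w z \<and> (\<lambda>n. norm (w n)) \<longlonglongrightarrow> norm z \<and>
      second_subderiv j x g z = ereal (Q z) \<and>
      (\<lambda>n. second_quot j x g (t n) (w n)) \<longlonglongrightarrow> second_subderiv j x g z"
    if z: "z \<in> critical_set j x g" and t: "pos_decreasing_null t" for z t
  proof -
    obtain zk where zk: "\<And>k. zk k \<in> Z" "weak_star_lim zk z" "(\<lambda>k. norm (zk k)) \<longlonglongrightarrow> norm z"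
        "liminf (\<lambda>k. ereal (Q (zk k))) \<le> ereal (Q z)"
      using iii[OF z] by blast
    \<comment> \<open>All approximants \<open>zk k\<close> receive recovery sequences along the same
      \<open>t\<close>, which makes the diagonal over \<open>k\<close> and \<open>n\<close>
      possible.\<close>
    obtain zs where zs: "\<And>k. weak_star_lim (zs k) (zk k)"
        "\<And>k. (\<lambda>n. norm (zs k n)) \<longlonglongrightarrow> norm (zk k)"
        "\<And>k. (\<lambda>n. second_quot j x g (t n) (zs k n)) \<longlonglongrightarrow> ereal (Q (zk k))"
      using ii[OF zk(1) t] by metis
    obtain w where w: "weak_star_lim w z" "(\<lambda>n. norm (w n)) \<longlonglongrightarrow> norm z"
        "\<And>m. \<forall>\<^sub>F n in sequentially. second_quot j x g (t n) (w n) < ereal (Q z + 1 / (real m + 1))"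
      using weak_star_recovery[where f = "\<lambda>n. second_quot j x g (t n)", OF space zk(2,3,4) zs]
      by blast
    show ?thesis
      using w(1,2) recovery_limit[OF t w(1) i[OF z] w(3)] by auto
  qed
  \<comment> \<open>\<open>weak\<close> yields the equality only in the presence of some null
    sequence \<open>t\<close>, so a concrete one is supplied.\<close>
  have "pos_decreasing_null (\<lambda>n. inverse (real (Suc n)))"
    using LIMSEQ_inverse_real_of_nat
    by (auto simp: pos_decreasing_null_def decseq_def intro!: le_imp_inverse_le)
  then have eq: "ereal (Q z) = second_subderiv j x g z" if "z \<in> critical_set j x g" for z
    using weak[OF that] by metis
  moreover have "strictly_twice_epi_diff j x g"
    unfolding strictly_twice_epi_diff_def
  proof (intro allI impI)
    fix z t
    assume t: "pos_decreasing_null t"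
    show "\<exists>zs. weak_star_lim zs z \<and> (\<lambda>n. norm (zs n)) \<longlonglongrightarrow> norm z \<and>
            (\<lambda>n. second_quot j x g (t n) (zs n)) \<longlonglongrightarrow> second_subderiv j x g z"
    proof (cases "z \<in> critical_set j x g")
      case True
      then show ?thesis
        using weak[OF _ t] by blast
    next
      case False
      then show ?thesis
        using second_quot_const_tendsto[OF t False] weak_star_lim_const[of z]
        by (intro exI[of _ "\<lambda>_. z"]) simp
    qed
  qed
  moreover have "strongly_twice_epi_diff j x g"
    if ii': "\<forall>z\<in>Z. \<forall>t. pos_decreasing_null t \<longrightarrow>
         (\<exists>zs. zs \<longlonglongrightarrow> z \<and> (\<lambda>n. second_quot j x g (t n) (zs n)) \<longlonglongrightarrow> ereal (Q z))"
      and iii': "\<forall>z\<in>critical_set j x g. \<exists>zs. (\<forall>k. zs k \<in> Z) \<and> zs \<longlonglongrightarrow> z \<and>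
         ereal (Q z) \<ge> liminf (\<lambda>k. ereal (Q (zs k)))"
    unfolding strongly_twice_epi_diff_def
  proof (intro allI impI)
    fix z t
    assume t: "pos_decreasing_null t"
    show "\<exists>zs. zs \<longlonglongrightarrow> z \<and>
            (\<lambda>n. second_quot j x g (t n) (zs n)) \<longlonglongrightarrow> second_subderiv j x g z"
    proof (cases "z \<in> critical_set j x g")
      case True
      then obtain zk where zk: "\<And>k. zk k \<in> Z" "zk \<longlonglongrightarrow> z"
          "liminf (\<lambda>k. ereal (Q (zk k))) \<le> ereal (Q z)"
        using iii' by blast
      have "\<exists>zs. zs \<longlonglongrightarrow> zk k \<and> (\<lambda>n. second_quot j x g (t n) (zs n)) \<longlonglongrightarrow> ereal (Q (zk k))" for k
        using ii' zk(1) t by blast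
      then obtain zs where zs: "\<And>k. zs k \<longlonglongrightarrow> zk k"
          "\<And>k. (\<lambda>n. second_quot j x g (t n) (zs k n)) \<longlonglongrightarrow> ereal (Q (zk k))"
        by metis
      obtain w where w: "w \<longlonglongrightarrow> z"
          "\<And>m. \<forall>\<^sub>F n in sequentially. second_quot j x g (t n) (w n) < ereal (Q z + 1 / (real m + 1))"
        using strong_recovery[where f = "\<lambda>n. second_quot j x g (t n)", OF zk(2,3) zs] by blast
      \<comment> \<open>Norm convergence implies weak-star convergence, so the lower bound by the
        second subderivative applies to \<open>w\<close> as well.\<close>
      show ?thesis
        using w(1) recovery_limit[OF t tendsto_imp_weak_star_lim[OF w(1)] i[OF True] w(2)] by auto
    next
      case False
      then show ?thesis
        using second_quot_const_tendsto[OF t False] by (intro exI[of _ "\<lambda>_. z"]) simp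
    qed
  qed
  ultimately show ?thesis
    by blast
qed

end
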